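(* (Working in $\mathsf{ZF}$.) Suppose that $\lambda$ is a singular cardinal with $\operatorname{cf}(\lambda)=\kappa$. If there is a uniform ultrafilter on $\lambda$, then there is a uniform ultrafilter on $\kappa$.
   Context: No form of the axiom of choice is assumed. An ultrafilter $\mathcal F$ on a set $X$ is uniform if every $A\in\mathcal F$ has the same cardinality as $X$. *)

theory Defs
  imports Main
begin

text \<open>
  Isabelle/HOL has choice built in, so a statement of ZF cannot be rendered by one about HOL sets.
  It is rendered as truth in every first-order model of ZF, which by Goedel's completeness theorem
  is the same as provability in ZF.  A structure for the language of set theory is a type \<open>'a\<close>
  with a binary relation \<open>\<epsilon>\<close> (not assumed well-founded, and not
  assumed to satisfy choice).  Separation and Replacement are the first-order schemas, so they range
  over formulas with parameters and not over arbitrary HOL predicates.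

  All set-theoretic notions below quantify over elements of \<open>'a\<close> only; each is the
  interpretation in \<open>('a, \<epsilon>)\<close> of a first-order formula in the single
  symbol \<open>\<epsilon>\<close>.
\<close>

datatype fm = Mem nat nat | Equal nat nat | Neg fm | Conj fm fm | All nat fm

primrec sat :: "('a \<Rightarrow> 'a \<Rightarrow> bool) \<Rightarrow> fm \<Rightarrow> (nat \<Rightarrow> 'a) \<Rightarrow> bool" where
  "sat E (Mem i j) e \<longleftrightarrow> E (e i) (e j)"
| "sat E (Equal i j) e \<longleftrightarrow> e i = e j"
| "sat E (Neg p) e \<longleftrightarrow> \<not> sat E p e"
| "sat E (Conj p q) e \<longleftrightarrow> sat E p e \<and> sat E q e"
| "sat E (All i p) e \<longleftrightarrow> (\<forall>x. sat E p (e(i := x)))"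

locale set_structure =
  fixes mem :: "'a \<Rightarrow> 'a \<Rightarrow> bool" (infix \<open>\<epsilon>\<close> 50)
begin

definition is_subset :: "'a \<Rightarrow> 'a \<Rightarrow> bool" where
  "is_subset a b \<longleftrightarrow> (\<forall>x. x \<epsilon> a \<longrightarrow> x \<epsilon> b)"

definition is_empty :: "'a \<Rightarrow> bool" where
  "is_empty a \<longleftrightarrow> (\<forall>x. \<not> x \<epsilon> a)"

definition is_succ :: "'a \<Rightarrow> 'a \<Rightarrow> bool" where
  "is_succ s a \<longleftrightarrow> (\<forall>x. x \<epsilon> s \<longleftrightarrow> x \<epsilon> a \<or> x = a)"

definition is_upair :: "'a \<Rightarrow> 'a \<Rightarrow> 'a \<Rightarrow> bool" where
  "is_upair p a b \<longleftrightarrow> (\<forall>x. x \<epsilon> p \<longleftrightarrow> x = a \<or> x = b)"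

text \<open>Kuratowski pairs.\<close>

definition is_pair :: "'a \<Rightarrow> 'a \<Rightarrow> 'a \<Rightarrow> bool" where
  "is_pair p a b \<longleftrightarrow> (\<exists>u v. is_upair u a a \<and> is_upair v a b \<and> is_upair p u v)"

definition maps_to :: "'a \<Rightarrow> 'a \<Rightarrow> 'a \<Rightarrow> bool" where
  "maps_to f x y \<longleftrightarrow> (\<exists>p. p \<epsilon> f \<and> is_pair p x y)"

definition is_function :: "'a \<Rightarrow> 'a \<Rightarrow> 'a \<Rightarrow> bool" where
  "is_function f a b \<longleftrightarrow>
     (\<forall>p. p \<epsilon> f \<longrightarrow> (\<exists>x y. x \<epsilon> a \<and> y \<epsilon> b \<and> is_pair p x y)) \<and>
     (\<forall>x. x \<epsilon> a \<longrightarrow> (\<exists>!y. maps_to f x y))"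

definition is_bijection :: "'a \<Rightarrow> 'a \<Rightarrow> 'a \<Rightarrow> bool" where
  "is_bijection f a b \<longleftrightarrow>
     is_function f a b \<and>
     (\<forall>x x' y. maps_to f x y \<and> maps_to f x' y \<longrightarrow> x = x') \<and>
     (\<forall>y. y \<epsilon> b \<longrightarrow> (\<exists>x. maps_to f x y))"

definition equipotent :: "'a \<Rightarrow> 'a \<Rightarrow> bool" where
  "equipotent a b \<longleftrightarrow> (\<exists>f. is_bijection f a b)"

definition is_transitive :: "'a \<Rightarrow> bool" where
  "is_transitive a \<longleftrightarrow> (\<forall>x. x \<epsilon> a \<longrightarrow> is_subset x a)"

definition wellordered_by_mem :: "'a \<Rightarrow> bool" where
  "wellordered_by_mem a \<longleftrightarrow>
     (\<forall>x. x \<epsilon> a \<longrightarrow> \<not> x \<epsilon> x) \<and>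
     (\<forall>x y z. x \<epsilon> a \<and> y \<epsilon> a \<and> z \<epsilon> a \<and> x \<epsilon> y \<and> y \<epsilon> z \<longrightarrow> x \<epsilon> z) \<and>
     (\<forall>x y. x \<epsilon> a \<and> y \<epsilon> a \<longrightarrow> x \<epsilon> y \<or> x = y \<or> y \<epsilon> x) \<and>
     (\<forall>b. is_subset b a \<and> \<not> is_empty b \<longrightarrow> (\<exists>x. x \<epsilon> b \<and> (\<forall>y. y \<epsilon> b \<longrightarrow> x = y \<or> x \<epsilon> y)))"

definition is_ordinal :: "'a \<Rightarrow> bool" where
  "is_ordinal a \<longleftrightarrow> is_transitive a \<and> wellordered_by_mem a"

text \<open>Von Neumann natural numbers of the structure, possibly nonstandard.\<close>

definition is_natural :: "'a \<Rightarrow> bool" where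
  "is_natural n \<longleftrightarrow>
     is_ordinal n \<and>
     (\<forall>m. m = n \<or> m \<epsilon> n \<longrightarrow> is_empty m \<or> (\<exists>k. is_succ m k))"

definition is_cardinal :: "'a \<Rightarrow> bool" where
  "is_cardinal a \<longleftrightarrow> is_ordinal a \<and> (\<forall>b. b \<epsilon> a \<longrightarrow> \<not> equipotent b a)"

definition is_cofinal_map :: "'a \<Rightarrow> 'a \<Rightarrow> 'a \<Rightarrow> bool" where
  "is_cofinal_map f a l \<longleftrightarrow>
     is_function f a l \<and>
     (\<forall>b. b \<epsilon> l \<longrightarrow> (\<exists>x y. x \<epsilon> a \<and> maps_to f x y \<and> (b = y \<or> b \<epsilon> y)))"

definition is_cofinality :: "'a \<Rightarrow> 'a \<Rightarrow> bool" where
  "is_cofinality k l \<longleftrightarrow>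
     is_ordinal k \<and> (\<exists>f. is_cofinal_map f k l) \<and>
     (\<forall>a. a \<epsilon> k \<longrightarrow> \<not> (\<exists>f. is_cofinal_map f a l))"

definition is_singular_cardinal :: "'a \<Rightarrow> bool" where
  "is_singular_cardinal l \<longleftrightarrow>
     is_cardinal l \<and> \<not> is_natural l \<and> (\<exists>k. is_cofinality k l \<and> k \<epsilon> l)"

definition is_ultrafilter_on :: "'a \<Rightarrow> 'a \<Rightarrow> bool" where
  "is_ultrafilter_on F X \<longleftrightarrow>
     (\<forall>A. A \<epsilon> F \<longrightarrow> is_subset A X) \<and>
     X \<epsilon> F \<and>
     (\<forall>A. A \<epsilon> F \<longrightarrow> \<not> is_empty A) \<and>
     (\<forall>A B. A \<epsilon> F \<and> is_subset A B \<and> is_subset B X \<longrightarrow> B \<epsilon> F) \<and>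
     (\<forall>A B. A \<epsilon> F \<and> B \<epsilon> F \<longrightarrow> (\<exists>C. C \<epsilon> F \<and> (\<forall>x. x \<epsilon> C \<longleftrightarrow> x \<epsilon> A \<and> x \<epsilon> B))) \<and>
     (\<forall>A. is_subset A X \<longrightarrow> A \<epsilon> F \<or> (\<exists>C. C \<epsilon> F \<and> (\<forall>x. x \<epsilon> C \<longleftrightarrow> x \<epsilon> X \<and> \<not> x \<epsilon> A)))"

definition is_uniform_ultrafilter_on :: "'a \<Rightarrow> 'a \<Rightarrow> bool" where
  "is_uniform_ultrafilter_on F X \<longleftrightarrow>
     is_ultrafilter_on F X \<and> (\<forall>A. A \<epsilon> F \<longrightarrow> equipotent A X)"

end

text \<open>
  In the two schemas the environment \<open>e\<close> supplies the parameters of the formula \<open>p\<close>.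
\<close>

locale ZF_model = set_structure +
  assumes extensionality: "(\<forall>x. x \<epsilon> a \<longleftrightarrow> x \<epsilon> b) \<Longrightarrow> a = b"
    and foundation: "\<not> is_empty a \<Longrightarrow> \<exists>x. x \<epsilon> a \<and> (\<forall>y. y \<epsilon> x \<longrightarrow> \<not> y \<epsilon> a)"
    and pairing: "\<exists>p. is_upair p a b"
    and union: "\<exists>u. \<forall>x. x \<epsilon> u \<longleftrightarrow> (\<exists>y. x \<epsilon> y \<and> y \<epsilon> a)"
    and powerset: "\<exists>P. \<forall>x. x \<epsilon> P \<longleftrightarrow> is_subset x a"
    and infinity: "\<exists>w. (\<exists>z. z \<epsilon> w \<and> is_empty z) \<and> (\<forall>x. x \<epsilon> w \<longrightarrow> (\<exists>s. s \<epsilon> w \<and> is_succ s x))"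
    and separation: "\<exists>b. \<forall>x. x \<epsilon> b \<longleftrightarrow> x \<epsilon> a \<and> sat (\<epsilon>) p (e(0 := x))"
    and replacement:
      "(\<forall>x y z. x \<epsilon> a \<and> sat (\<epsilon>) p (e(0 := x, 1 := y)) \<and> sat (\<epsilon>) p (e(0 := x, 1 := z)) \<longrightarrow> y = z) \<Longrightarrow>
       \<exists>b. \<forall>y. y \<epsilon> b \<longleftrightarrow> (\<exists>x. x \<epsilon> a \<and> sat (\<epsilon>) p (e(0 := x, 1 := y)))"

end

theory Submission
  imports Defs
begin

text \<open>
  Let \<open>f\<close> be a cofinal map from \<open>\<kappa>\<close> to \<open>\<lambda>\<close> and send \<open>\<alpha> \<in> \<lambda>\<close> to the least \<open>i \<in> \<kappa>\<close> with
  \<open>\<alpha> \<le> f i\<close>.  The image of the given ultrafilter under this map is an ultrafilter on \<open>\<kappa>\<close>.  If \<open>A\<close>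
  belongs to it, the preimage of \<open>A\<close> is equipotent to the cardinal \<open>\<lambda>\<close> and hence unbounded
  in \<open>\<lambda>\<close>, so \<open>f\<close> restricted to \<open>A\<close> is still cofinal; by minimality of \<open>\<kappa>\<close> the order type of \<open>A\<close>
  is \<open>\<kappa>\<close>.
\<close>

section \<open>Definability with parameters\<close>

text \<open>The index of a quantifier is renamed together with the other variables, so an injective
  renaming causes no capture.\<close>

primrec rename :: "(nat \<Rightarrow> nat) \<Rightarrow> fm \<Rightarrow> fm" where
  "rename r (Mem i j) = Mem (r i) (r j)"
| "rename r (Equal i j) = Equal (r i) (r j)"
| "rename r (Neg p) = Neg (rename r p)"
| "rename r (Conj p q) = Conj (rename r p) (rename r q)"
| "rename r (All i p) = All (r i) (rename r p)"

lemma sat_rename: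
  assumes "inj r"
  shows "sat E (rename r p) e \<longleftrightarrow> sat E p (\<lambda>n. e (r n))"
proof (induction p arbitrary: e)
  case (All i p)
  have "(\<lambda>n. (e(r i := x)) (r n)) = (\<lambda>n. e (r n))(i := x)" for x
    using assms by (auto simp: fun_eq_iff inj_eq)
  with All show ?case by simp
qed simp_all

text \<open>This bounds the variables that matter to a formula, so that \<open>definable_all\<close>
  can find a fresh index to quantify over.\<close>

lemma sat_depends_on_finitely_many:
  "\<exists>N. \<forall>e e'. (\<forall>n<N. e n = e' n) \<longrightarrow> sat E p e = sat E p e'"
proof (induction p)
  case (Mem i j)
  show ?case by (rule exI[of _ "Suc (max i j)"]) (simp add: less_Suc_eq_le)
next
  case (Equal i j)
  show ?case by (rule exI[of _ "Suc (max i j)"]) (simp add: less_Suc_eq_le)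
next
  case (Neg p)
  then show ?case by auto
next
  case (Conj p q)
  then obtain N M where
    "\<forall>e e'. (\<forall>n<N. e n = e' n) \<longrightarrow> sat E p e = sat E p e'"
    "\<forall>e e'. (\<forall>n<M. e n = e' n) \<longrightarrow> sat E q e = sat E q e'" by blast
  then have "\<forall>e e'. (\<forall>n<max N M. e n = e' n) \<longrightarrow> sat E (Conj p q) e = sat E (Conj p q) e'"
    by (metis less_max_iff_disj sat.simps(4))
  then show ?case by blast
next
  case (All i p)
  then obtain N where N: "\<And>e e'. (\<forall>n<N. e n = e' n) \<Longrightarrow> sat E p e = sat E p e'" by blast
  have "sat E (All i p) e = sat E (All i p) e'" if "\<forall>n<N. e n = e' n" for e e'
  proof -
    have "sat E p (e(i := x)) = sat E p (e'(i := x))" for x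
      using that by (intro N) simp
    then show ?thesis by simp
  qed
  then show ?case by blast
qed

text \<open>Even variables are read from the environment, odd ones from the parameters.\<close>

definition merge :: "(nat \<Rightarrow> 'a) \<Rightarrow> (nat \<Rightarrow> 'a) \<Rightarrow> nat \<Rightarrow> 'a" where
  "merge e c n = (if even n then e (n div 2) else c (n div 2))"

text \<open>These are the terms of the language expanded by a constant for every element of the
  structure.\<close>

definition var_or_const :: "((nat \<Rightarrow> 'a) \<Rightarrow> 'a) \<Rightarrow> bool" where
  "var_or_const t \<longleftrightarrow> (\<exists>i. t = (\<lambda>e. e i)) \<or> (\<exists>a. t = (\<lambda>e. a))"

lemma var_or_const_var: "var_or_const (\<lambda>e. e i)"
  and var_or_const_const: "var_or_const (\<lambda>e. a)"
  unfolding var_or_const_def by blast+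

lemma var_or_const_pair:
  assumes "var_or_const s" "var_or_const t"
  shows "\<exists>c i j. \<forall>e. merge e c i = s e \<and> merge e c j = t e"
proof -
  \<comment> \<open>The terms get separate parameter slots, slot 0 (index 1 of \<open>merge\<close>)
    for \<open>s\<close> and slot 1 (index 3) for \<open>t\<close>. Each claim leaves the other slot
    arbitrary, so the two combine.\<close>
  have "\<exists>i a. \<forall>b e. merge e (\<lambda>n. if n = 0 then a else b) i = s e"
    using assms(1) unfolding var_or_const_def
  proof (elim disjE exE)
    fix i assume "s = (\<lambda>e. e i)"
    then show ?thesis by (intro exI[of _ "2 * i"]) (simp add: merge_def)
  next
    fix a assume "s = (\<lambda>e. a)"
    then show ?thesis by (intro exI[of _ 1] exI[of _ a]) (simp add: merge_def)
  qed
  moreover have "\<exists>j b. \<forall>a e. merge e (\<lambda>n. if n = 0 then a else b) j = t e"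
    using assms(2) unfolding var_or_const_def
  proof (elim disjE exE)
    fix i assume "t = (\<lambda>e. e i)"
    then show ?thesis by (intro exI[of _ "2 * i"]) (simp add: merge_def)
  next
    fix a assume "t = (\<lambda>e. a)"
    then show ?thesis by (intro exI[of _ 3] exI[of _ a]) (simp add: merge_def)
  qed
  ultimately show ?thesis by blast
qed

context set_structure
begin

text \<open>A HOL predicate on environments stands for a formula, so that the schemas can be applied
  to ordinary HOL notation once definability has been derived by following the syntax of the
  predicate.\<close>

definition definable :: "((nat \<Rightarrow> 'a) \<Rightarrow> bool) \<Rightarrow> bool" where
  "definable P \<longleftrightarrow> (\<exists>p c. \<forall>e. P e \<longleftrightarrow> sat (\<epsilon>) p (merge e c))"

lemma definable_mem:
  assumes "var_or_const s" "var_or_const t"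
  shows "definable (\<lambda>e. s e \<epsilon> t e)"
proof -
  obtain c i j where "\<forall>e. merge e c i = s e \<and> merge e c j = t e"
    using var_or_const_pair[OF assms] by blast
  then have "\<forall>e. s e \<epsilon> t e \<longleftrightarrow> sat (\<epsilon>) (Mem i j) (merge e c)" by simp
  then show ?thesis unfolding definable_def by blast
qed

lemma definable_eq:
  assumes "var_or_const s" "var_or_const t"
  shows "definable (\<lambda>e. s e = t e)"
proof -
  obtain c i j where "\<forall>e. merge e c i = s e \<and> merge e c j = t e"
    using var_or_const_pair[OF assms] by blast
  then have "\<forall>e. s e = t e \<longleftrightarrow> sat (\<epsilon>) (Equal i j) (merge e c)" by simp
  then show ?thesis unfolding definable_def by blast
qed

lemma definable_not:
  assumes "definable P"
  shows "definable (\<lambda>e. \<not> P e)"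
proof -
  obtain p c where "\<And>e. P e \<longleftrightarrow> sat (\<epsilon>) p (merge e c)"
    using assms unfolding definable_def by blast
  then show ?thesis
    unfolding definable_def by (intro exI[of _ "Neg p"] exI[of _ c]) simp
qed

lemma definable_conj:
  assumes "definable P" "definable Q"
  shows "definable (\<lambda>e. P e \<and> Q e)"
proof -
  obtain p c q d where p: "\<And>e. P e \<longleftrightarrow> sat (\<epsilon>) p (merge e c)"
    and q: "\<And>e. Q e \<longleftrightarrow> sat (\<epsilon>) q (merge e d)"
    using assms unfolding definable_def by blast
  \<comment> \<open>The two formulas come with their own parameter sequences. The odd indices are
    split by residue modulo 4: residue 1 reads \<open>c\<close> and residue 3 reads \<open>d\<close>
    out of \<open>merge c d\<close>, while the environment stays shared.\<close>
  define r :: "nat \<Rightarrow> nat" where "r n = (if even n then n else 4 * (n div 2) + 1)" for n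
  define s :: "nat \<Rightarrow> nat" where "s n = (if even n then n else 4 * (n div 2) + 3)" for n
  have "inj r" "inj s"
    unfolding inj_def r_def s_def by (auto split: if_splits elim!: evenE oddE) presburger+
  moreover have "(4 * b + 3) div 2 = Suc (2 * b)" for b :: nat
    by presburger
  then have "(\<lambda>n. merge e (merge c d) (r n)) = merge e c"
    "(\<lambda>n. merge e (merge c d) (s n)) = merge e d" for e
    by (auto simp: fun_eq_iff merge_def r_def s_def elim!: evenE oddE)
  ultimately show ?thesis
    unfolding definable_def
    by (intro exI[of _ "Conj (rename r p) (rename s q)"] exI[of _ "merge c d"])
      (simp add: sat_rename p q)
qed

text \<open>De Bruijn style: the quantified variable becomes variable \<open>0\<close> of the environment.\<close>

lemma definable_all:
  assumes "definable (\<lambda>e. Q (e 0) (\<lambda>n. e (Suc n)))"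
  shows "definable (\<lambda>e. \<forall>x. Q x e)"
proof -
  obtain p c where p: "\<And>e. Q (e 0) (\<lambda>n. e (Suc n)) \<longleftrightarrow> sat (\<epsilon>) p (merge e c)"
    using assms unfolding definable_def by blast
  have Q: "Q x e \<longleftrightarrow> sat (\<epsilon>) p (merge (case_nat x e) c)" for x e
    using p[of "case_nat x e"] by simp
  obtain N where N: "\<And>e e'. (\<forall>n<N. e n = e' n) \<Longrightarrow> sat (\<epsilon>) p e = sat (\<epsilon>) p e'"
    using sat_depends_on_finitely_many by blast
  \<comment> \<open>This permutes the even indices up to \<open>2 * N\<close> cyclically. The
    variable to be bound moves from 0 to \<open>2 * N\<close>, and the remaining environment
    variables move down one place, which undoes the de Bruijn shift. Only indices below
    \<open>N\<close> affect \<open>p\<close>; the others have to be treated so as to keep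
    \<open>r\<close> injective.\<close>
  define r where "r n = (if n = 0 then 2 * N else if even n \<and> n \<le> 2 * N then n - 2 else n)" for n
  have "inj r"
    unfolding inj_def r_def by (auto split: if_splits) presburger+
  moreover have "((merge e c)(2 * N := x)) (r n) = merge (case_nat x e) c n" if "n < N" for e x n
    using that by (auto simp: merge_def r_def split: nat.split elim!: evenE oddE)
  ultimately have "sat (\<epsilon>) (rename r p) ((merge e c)(2 * N := x))
      = sat (\<epsilon>) p (merge (case_nat x e) c)" for e x
    unfolding sat_rename[OF \<open>inj r\<close>] by (intro N) blast
  then show ?thesis
    unfolding definable_def
    by (intro exI[of _ "All (2 * N) (rename r p)"] exI[of _ c]) (simp add: Q)
qed

lemma definable_imp:
  assumes "definable P" "definable Q"
  shows "definable (\<lambda>e. P e \<longrightarrow> Q e)"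
  using definable_not[OF definable_conj[OF assms(1) definable_not[OF assms(2)]]] by simp

lemma definable_disj:
  assumes "definable P" "definable Q"
  shows "definable (\<lambda>e. P e \<or> Q e)"
  using definable_imp[OF definable_not[OF assms(1)] assms(2)]
  by (simp add: disj_imp)

lemma definable_iff:
  assumes "definable P" "definable Q"
  shows "definable (\<lambda>e. P e \<longleftrightarrow> Q e)"
  using definable_conj[OF definable_imp[OF assms] definable_imp[OF assms(2,1)]]
  by (simp add: iff_conv_conj_imp)

lemma definable_ex:
  assumes "definable (\<lambda>e. Q (e 0) (\<lambda>n. e (Suc n)))"
  shows "definable (\<lambda>e. \<exists>x. Q x e)"
  using definable_not[OF definable_all, of "\<lambda>x e. \<not> Q x e"] definable_not[OF assms] by simp

lemmas definable_intros =
  definable_all definable_ex definable_imp definable_iff definable_conj definable_disj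
  definable_not definable_mem definable_eq var_or_const_var var_or_const_const

lemmas definable_unfolds = maps_to_def is_pair_def is_upair_def

definition definable1 :: "('a \<Rightarrow> bool) \<Rightarrow> bool" where
  "definable1 P \<longleftrightarrow> (\<forall>i. definable (\<lambda>e. P (e i)))"

text \<open>All pairs of indices are covered because quantifiers placed around \<open>R\<close>
  shift its arguments, as happens in \<open>definable_set_of_pairs\<close>.\<close>

definition definable2 :: "('a \<Rightarrow> 'a \<Rightarrow> bool) \<Rightarrow> bool" where
  "definable2 R \<longleftrightarrow> (\<forall>i j. definable (\<lambda>e. R (e i) (e j)))"

end

section \<open>Sets of pairs and equipotence\<close>

context ZF_model
begin

lemma definable_separation:
  assumes "definable1 P"
  shows "\<exists>b. \<forall>x. x \<epsilon> b \<longleftrightarrow> x \<epsilon> a \<and> P x"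
proof -
  have "definable (\<lambda>e. P (e 0))"
    using assms unfolding definable1_def by blast
  then obtain p c where p: "\<And>e. P (e 0) \<longleftrightarrow> sat (\<epsilon>) p (merge e c)"
    unfolding definable_def by blast
  \<comment> \<open>Index 0 is even and reads position 0 of the environment, so the update made by
    the schema passes through \<open>merge\<close>. Elsewhere \<open>a\<close> is a mere
    filler.\<close>
  have "(merge (\<lambda>_. a) c)(0 := x) = merge ((\<lambda>_. a)(0 := x)) c" for x
    by (auto simp: fun_eq_iff merge_def)
  then have "sat (\<epsilon>) p ((merge (\<lambda>_. a) c)(0 := x)) \<longleftrightarrow> P x" for x
    using p[of "(\<lambda>_. a)(0 := x)"] by simp
  then show ?thesis
    using separation[of a p "merge (\<lambda>_. a) c"] by simp
qed

lemma ex_pair: "\<exists>p. is_pair p x y"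
  unfolding is_pair_def using pairing by blast

lemma pair_inject:
  assumes "is_pair p x y" "is_pair p x' y'"
  shows "x = x' \<and> y = y'"
proof -
  obtain u v where uv: "\<And>z. z \<epsilon> u \<longleftrightarrow> z = x" "\<And>z. z \<epsilon> v \<longleftrightarrow> z = x \<or> z = y"
    "\<And>z. z \<epsilon> p \<longleftrightarrow> z = u \<or> z = v"
    using assms(1) unfolding is_pair_def is_upair_def by auto
  obtain u' v' where uv': "\<And>z. z \<epsilon> u' \<longleftrightarrow> z = x'" "\<And>z. z \<epsilon> v' \<longleftrightarrow> z = x' \<or> z = y'"
    "\<And>z. z \<epsilon> p \<longleftrightarrow> z = u' \<or> z = v'"
    using assms(2) unfolding is_pair_def is_upair_def by auto
  have eq: "z = u \<or> z = v \<longleftrightarrow> z = u' \<or> z = v'" for z using uv(3) uv'(3) by blast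
  have "u = u' \<or> u = v'" "u' = u \<or> u' = v" using eq by blast+
  then have x: "x = x'" using uv(1,2) uv'(1,2) by metis
  have "v = u' \<or> v = v'" "v' = u \<or> v' = v" using eq by blast+
  then have "y = y'" using uv(1,2) uv'(1,2) x by metis
  with x show ?thesis ..
qed

text \<open>The relation is separated from the double power set of the union of \<open>a\<close> and
  \<open>b\<close>, which contains every Kuratowski pair with coordinates in \<open>a\<close> and
  \<open>b\<close>.\<close>

lemma definable_set_of_pairs:
  assumes "definable2 R"
  shows "\<exists>r. (\<forall>p. p \<epsilon> r \<longrightarrow> (\<exists>x y. x \<epsilon> a \<and> y \<epsilon> b \<and> is_pair p x y))
    \<and> (\<forall>x y. maps_to r x y \<longleftrightarrow> x \<epsilon> a \<and> y \<epsilon> b \<and> R x y)"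
proof -
  obtain d where d: "is_upair d a b" using pairing by blast
  obtain u where u: "\<And>x. x \<epsilon> u \<longleftrightarrow> x \<epsilon> a \<or> x \<epsilon> b"
    using union[of d] d unfolding is_upair_def by metis
  obtain P where P: "\<And>x. x \<epsilon> P \<longleftrightarrow> is_subset x u" using powerset by blast
  obtain PP where PP: "\<And>x. x \<epsilon> PP \<longleftrightarrow> is_subset x P" using powerset by blast
  have pair_PP: "p \<epsilon> PP" if "is_pair p x y" "x \<epsilon> a" "y \<epsilon> b" for p x y
    using that unfolding PP P is_pair_def is_upair_def is_subset_def u by metis
  have R: "definable (\<lambda>e. R (e i) (e j))" for i j
    using assms unfolding definable2_def by blast
  have "definable1 (\<lambda>p. \<exists>x y. x \<epsilon> a \<and> y \<epsilon> b \<and> is_pair p x y \<and> R x y)"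
    unfolding definable1_def definable_unfolds by (intro allI R definable_intros)
  from definable_separation[OF this, of PP] obtain r
    where "\<forall>p. p \<epsilon> r \<longleftrightarrow> p \<epsilon> PP \<and> (\<exists>x y. x \<epsilon> a \<and> y \<epsilon> b \<and> is_pair p x y \<and> R x y)" ..
  then have r: "p \<epsilon> r \<longleftrightarrow> (\<exists>x y. x \<epsilon> a \<and> y \<epsilon> b \<and> is_pair p x y \<and> R x y)" for p
    using pair_PP by blast
  have "maps_to r x y \<longleftrightarrow> x \<epsilon> a \<and> y \<epsilon> b \<and> R x y" for x y
    unfolding maps_to_def r using ex_pair pair_inject by metis
  moreover have "\<exists>x y. x \<epsilon> a \<and> y \<epsilon> b \<and> is_pair p x y" if "p \<epsilon> r" for p
    using that r by blast
  ultimately show ?thesis by blast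
qed

lemma definable_function:
  assumes "definable2 R" "\<And>x. x \<epsilon> a \<Longrightarrow> \<exists>!y. y \<epsilon> b \<and> R x y"
  shows "\<exists>f. is_function f a b \<and> (\<forall>x y. maps_to f x y \<longleftrightarrow> x \<epsilon> a \<and> y \<epsilon> b \<and> R x y)"
proof -
  obtain f where f_pairs: "\<forall>p. p \<epsilon> f \<longrightarrow> (\<exists>x y. x \<epsilon> a \<and> y \<epsilon> b \<and> is_pair p x y)"
    and f: "\<forall>x y. maps_to f x y \<longleftrightarrow> x \<epsilon> a \<and> y \<epsilon> b \<and> R x y"
    using definable_set_of_pairs[OF assms(1), of a b] by blast
  have "\<exists>!y. maps_to f x y" if "x \<epsilon> a" for x
    using f that assms(2)[OF that] by simp
  with f_pairs have "is_function f a b" unfolding is_function_def by blast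
  with f show ?thesis by blast
qed

lemma function_in:
  assumes "is_function f a b" "maps_to f x y"
  shows "x \<epsilon> a \<and> y \<epsilon> b"
proof -
  obtain p where p: "p \<epsilon> f" "is_pair p x y" using assms(2) unfolding maps_to_def by blast
  then obtain x' y' where "x' \<epsilon> a" "y' \<epsilon> b" "is_pair p x' y'"
    using assms(1) unfolding is_function_def by blast
  with pair_inject[OF p(2)] show ?thesis by blast
qed

lemma definable_equipotent:
  assumes "definable2 R"
    and "\<And>x. x \<epsilon> a \<Longrightarrow> \<exists>y. y \<epsilon> b \<and> R x y"
    and "\<And>y. y \<epsilon> b \<Longrightarrow> \<exists>x. x \<epsilon> a \<and> R x y"
    and "\<And>x y y'. x \<epsilon> a \<Longrightarrow> y \<epsilon> b \<Longrightarrow> y' \<epsilon> b \<Longrightarrow> R x y \<Longrightarrow> R x y' \<Longrightarrow> y = y'"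
    and "\<And>x x' y. x \<epsilon> a \<Longrightarrow> x' \<epsilon> a \<Longrightarrow> y \<epsilon> b \<Longrightarrow> R x y \<Longrightarrow> R x' y \<Longrightarrow> x = x'"
  shows "equipotent a b"
proof -
  have "\<And>x. x \<epsilon> a \<Longrightarrow> \<exists>!y. y \<epsilon> b \<and> R x y" using assms(2,4) by blast
  then obtain f where f: "is_function f a b" "\<And>x y. maps_to f x y \<longleftrightarrow> x \<epsilon> a \<and> y \<epsilon> b \<and> R x y"
    using definable_function[OF assms(1), of a b] by auto
  have "is_bijection f a b"
    unfolding is_bijection_def f(2) using f(1) assms(3,5) by blast
  then show ?thesis unfolding equipotent_def by blast
qed

lemma bijectionD:
  assumes "is_bijection f a b"
  shows "maps_to f x y \<Longrightarrow> x \<epsilon> a \<and> y \<epsilon> b"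
    and "x \<epsilon> a \<Longrightarrow> \<exists>y. maps_to f x y"
    and "y \<epsilon> b \<Longrightarrow> \<exists>x. maps_to f x y"
    and "maps_to f x y \<Longrightarrow> maps_to f x y' \<Longrightarrow> y = y'"
    and "maps_to f x y \<Longrightarrow> maps_to f x' y \<Longrightarrow> x = x'"
proof -
  have f: "is_function f a b" using assms unfolding is_bijection_def by blast
  show in_ab: "x \<epsilon> a \<and> y \<epsilon> b" if "maps_to f x y" for x y using function_in[OF f that] .
  have ex1: "\<exists>!y. maps_to f x y" if "x \<epsilon> a" for x
    using f that unfolding is_function_def by blast
  show "x \<epsilon> a \<Longrightarrow> \<exists>y. maps_to f x y" using ex1 by blast
  show "maps_to f x y \<Longrightarrow> maps_to f x y' \<Longrightarrow> y = y'" using ex1 in_ab by blast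
  show "y \<epsilon> b \<Longrightarrow> \<exists>x. maps_to f x y" "maps_to f x y \<Longrightarrow> maps_to f x' y \<Longrightarrow> x = x'"
    using assms unfolding is_bijection_def by blast+
qed

lemma equipotent_sym:
  assumes "equipotent a b"
  shows "equipotent b a"
proof -
  obtain f where "is_bijection f a b" using assms unfolding equipotent_def by blast
  note f = bijectionD[OF this]
  have "definable2 (\<lambda>y x. maps_to f x y)"
    unfolding definable2_def definable_unfolds by (intro allI definable_intros)
  then show ?thesis
  proof (rule definable_equipotent)
    show "\<exists>x. x \<epsilon> a \<and> maps_to f x y" if "y \<epsilon> b" for y using that f(1,3) by blast
    show "\<exists>y. y \<epsilon> b \<and> maps_to f x y" if "x \<epsilon> a" for x using that f(1,2) by blast
  qed (use f(4,5) in blast)+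
qed

lemma equipotent_trans:
  assumes "equipotent a b" "equipotent b c"
  shows "equipotent a c"
proof -
  obtain f g where fg: "is_bijection f a b" "is_bijection g b c"
    using assms unfolding equipotent_def by blast
  note f = bijectionD[OF fg(1)] and g = bijectionD[OF fg(2)]
  let ?R = "\<lambda>x z. \<exists>y. maps_to f x y \<and> maps_to g y z"
  have "definable2 ?R"
    unfolding definable2_def definable_unfolds by (intro allI definable_intros)
  then show ?thesis
  proof (rule definable_equipotent)
    show "\<exists>z. z \<epsilon> c \<and> ?R x z" if "x \<epsilon> a" for x
      using f(2)[OF that] f(1) g(1,2) by meson
    show "\<exists>x. x \<epsilon> a \<and> ?R x z" if "z \<epsilon> c" for z
      using g(3)[OF that] g(1) f(1,3) by meson
    show "z = z'" if "?R x z" "?R x z'" for x z z'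
      using that f(4) g(4) by blast
    show "x = x'" if "?R x z" "?R x' z" for x x' z
      using that f(5) g(5) by blast
  qed
qed

section \<open>Order types of sets of ordinals\<close>

lemma ordinal_transitive:
  assumes "is_ordinal k" "x \<epsilon> k" "y \<epsilon> x"
  shows "y \<epsilon> k"
  using assms unfolding is_ordinal_def is_transitive_def is_subset_def by blast

lemma ordinal_linear:
  assumes "is_ordinal k" "x \<epsilon> k" "y \<epsilon> k"
  shows "x \<epsilon> y \<or> x = y \<or> y \<epsilon> x"
proof -
  have "\<forall>x y. x \<epsilon> k \<and> y \<epsilon> k \<longrightarrow> x \<epsilon> y \<or> x = y \<or> y \<epsilon> x"
    using assms(1) unfolding is_ordinal_def wellordered_by_mem_def by (elim conjE)
  with assms(2,3) show ?thesis by blast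
qed

text \<open>Foundation is applied to the singleton of \<open>x\<close>.\<close>

lemma mem_irrefl: "\<not> x \<epsilon> x"
proof -
  obtain p where p: "\<And>z. z \<epsilon> p \<longleftrightarrow> z = x" using pairing[of x x] unfolding is_upair_def by auto
  then have "\<not> is_empty p" unfolding is_empty_def by blast
  from foundation[OF this] show ?thesis unfolding p by blast
qed

lemma ordinal_mem_trans:
  assumes "is_ordinal k" "z \<epsilon> k" "x \<epsilon> y" "y \<epsilon> z"
  shows "x \<epsilon> z"
proof -
  have "y \<epsilon> k" "x \<epsilon> k" using assms ordinal_transitive[OF assms(1)] by blast+
  then show ?thesis using assms unfolding is_ordinal_def wellordered_by_mem_def by blast
qed

lemma ordinal_element:
  assumes "is_ordinal k" "x \<epsilon> k"
  shows "is_ordinal x"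
proof -
  have "is_transitive x"
    unfolding is_transitive_def is_subset_def using ordinal_mem_trans[OF assms] by blast
  moreover have "is_subset x k"
    unfolding is_subset_def using ordinal_transitive[OF assms] by blast
  then have "wellordered_by_mem x"
    using assms unfolding is_ordinal_def wellordered_by_mem_def is_subset_def by meson
  ultimately show ?thesis unfolding is_ordinal_def by blast
qed

text \<open>This replaces induction along \<open>k\<close>. Definability is required because
  well-ordering in the structure speaks only of subsets that are elements of the structure.\<close>

lemma ordinal_least:
  assumes "is_ordinal k" "definable1 P" "x \<epsilon> k" "P x"
  shows "\<exists>m. m \<epsilon> k \<and> P m \<and> (\<forall>y. y \<epsilon> m \<longrightarrow> \<not> P y)"
proof -
  obtain b where b: "\<And>x. x \<epsilon> b \<longleftrightarrow> x \<epsilon> k \<and> P x"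
    using definable_separation[OF assms(2), of k] by auto
  then have "is_subset b k" "\<not> is_empty b"
    using assms(3,4) unfolding is_subset_def is_empty_def by blast+
  then obtain m where m: "m \<epsilon> b" "\<And>y. y \<epsilon> b \<Longrightarrow> m = y \<or> m \<epsilon> y"
    using assms(1) unfolding is_ordinal_def wellordered_by_mem_def by meson
  have mk: "m \<epsilon> k" "P m" using m(1) b by blast+
  have "\<not> P y" if y: "y \<epsilon> m" for y
  proof
    assume "P y"
    then have "m = y \<or> m \<epsilon> y" using m(2) b ordinal_transitive[OF assms(1) mk(1) y] by blast
    then show False using y mem_irrefl ordinal_mem_trans[OF assms(1) mk(1)] by blast
  qed
  with mk show ?thesis by blast
qed

text \<open>If \<open>d\<close> omits some element of \<open>k\<close>, it equals the least omitted
  \<open>x\<close>: everything below \<open>x\<close> is in \<open>d\<close>, and an element of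
  \<open>d\<close> equal to or above \<open>x\<close> would put \<open>x\<close> into the transitive
  set \<open>d\<close>.\<close>

lemma transitive_subset_ordinal:
  assumes k: "is_ordinal k" and "is_subset d k" "is_transitive d"
  shows "d = k \<or> d \<epsilon> k"
proof (cases "is_subset k d")
  case True
  then show ?thesis using assms extensionality unfolding is_subset_def by blast
next
  case False
  then obtain x0 where x0: "x0 \<epsilon> k" "\<not> x0 \<epsilon> d" unfolding is_subset_def by blast
  have "definable1 (\<lambda>x. \<not> x \<epsilon> d)"
    unfolding definable1_def by (intro allI definable_intros)
  from ordinal_least[OF k this x0] obtain x
    where x: "x \<epsilon> k" "\<not> x \<epsilon> d" "\<And>y. y \<epsilon> x \<Longrightarrow> y \<epsilon> d"
    by blast
  have "u \<epsilon> x" if "u \<epsilon> d" for u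
    using that x ordinal_linear[OF k, of u x] assms(2,3)
    unfolding is_subset_def is_transitive_def by blast
  with x(3) have "d = x" by (intro extensionality) blast
  with x(1) show ?thesis by blast
qed

text \<open>
  The graph of the Mostowski collapse of \<open>A\<close>, obtained without recursion as the greatest
  bisimulation between \<open>A\<close> and \<open>k\<close>.
\<close>

lemma collapse_bisimulation:
  "\<exists>D. \<forall>x y. maps_to D x y \<longleftrightarrow> x \<epsilon> A \<and> y \<epsilon> k
      \<and> (\<forall>u. u \<epsilon> A \<and> u \<epsilon> x \<longrightarrow> (\<exists>v. v \<epsilon> y \<and> maps_to D u v))
      \<and> (\<forall>v. v \<epsilon> y \<longrightarrow> (\<exists>u. u \<epsilon> A \<and> u \<epsilon> x \<and> maps_to D u v))"
proof -
  define step where "step S x y \<longleftrightarrow>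
      (\<forall>u. u \<epsilon> A \<and> u \<epsilon> x \<longrightarrow> (\<exists>v. v \<epsilon> y \<and> maps_to S u v))
      \<and> (\<forall>v. v \<epsilon> y \<longrightarrow> (\<exists>u. u \<epsilon> A \<and> u \<epsilon> x \<and> maps_to S u v))" for S x y
  have mono: "step T x y" if "step S x y" "\<And>u v. maps_to S u v \<Longrightarrow> maps_to T u v" for S T x y
    using that(1) unfolding step_def by (blast dest: that(2))
  \<comment> \<open>Bisimulations are the post-fixed points of the monotone operator
    \<open>step\<close>. Below, \<open>D\<close> is the union of those coded by elements of the
    structure, so the quantifier over them is first-order.\<close>
  define bisim where "bisim S \<longleftrightarrow> (\<forall>u v. maps_to S u v \<longrightarrow> u \<epsilon> A \<and> v \<epsilon> k \<and> step S u v)" for S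
  have "definable2 (\<lambda>x y. \<exists>S. maps_to S x y \<and> bisim S)"
    unfolding definable2_def bisim_def step_def definable_unfolds by (intro allI definable_intros)
  from definable_set_of_pairs[OF this, of A k] obtain D
    where "\<forall>x y. maps_to D x y \<longleftrightarrow> x \<epsilon> A \<and> y \<epsilon> k \<and> (\<exists>S. maps_to S x y \<and> bisim S)"
    by blast
  then have D: "maps_to D x y \<longleftrightarrow> (\<exists>S. maps_to S x y \<and> bisim S)" for x y
    unfolding bisim_def by blast
  have D_step: "x \<epsilon> A \<and> y \<epsilon> k \<and> step D x y" if "maps_to D x y" for x y
  proof -
    from D[THEN iffD1, OF that] obtain S where S: "maps_to S x y" "bisim S" by blast
    then have xy: "x \<epsilon> A" "y \<epsilon> k" "step S x y" unfolding bisim_def by blast+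
    have "step D x y"
      using xy(3) by (rule mono) (use D S(2) in blast)
    with xy show ?thesis by blast
  qed
  \<comment> \<open>As in the Knaster-Tarski theorem, applying the operator once more to
    \<open>D\<close> gives a bisimulation \<open>T\<close>, which is therefore contained in
    \<open>D\<close>. This turns the post-fixed point into a fixed point.\<close>
  have "definable2 (step D)"
    unfolding definable2_def step_def definable_unfolds by (intro allI definable_intros)
  from definable_set_of_pairs[OF this, of A k] obtain T
    where T: "\<forall>x y. maps_to T x y \<longleftrightarrow> x \<epsilon> A \<and> y \<epsilon> k \<and> step D x y"
    by blast
  have "bisim T"
    unfolding bisim_def
  proof (intro allI impI)
    fix u v assume "maps_to T u v"
    then have uv: "u \<epsilon> A" "v \<epsilon> k" "step D u v" using T by blast+
    have "step T u v"
      using uv(3) by (rule mono) (use D_step T in blast)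
    with uv show "u \<epsilon> A \<and> v \<epsilon> k \<and> step T u v" by blast
  qed
  then have "maps_to D x y" if "maps_to T x y" for x y
    using D[THEN iffD2] that by blast
  then have "maps_to D x y \<longleftrightarrow> x \<epsilon> A \<and> y \<epsilon> k \<and> step D x y" for x y
    using D_step T by blast
  then show ?thesis unfolding step_def by blast
qed

text \<open>The collapse \<open>D\<close> sends an element of \<open>A\<close> to the order type of
  its predecessors in \<open>A\<close>. Its range is a transitive subset of \<open>k\<close>, hence
  an ordinal up to \<open>k\<close>. Values never exceed their arguments, so \<open>k\<close> has
  room for the values of all of \<open>A\<close>.\<close>

lemma subset_ordinal_equipotent_ordinal:
  assumes k: "is_ordinal k" and Ak: "is_subset A k"
  shows "\<exists>d. (d = k \<or> d \<epsilon> k) \<and> equipotent A d"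
proof -
  from collapse_bisimulation[of A k] obtain D where D: "\<forall>x y. maps_to D x y \<longleftrightarrow> x \<epsilon> A \<and> y \<epsilon> k
      \<and> (\<forall>u. u \<epsilon> A \<and> u \<epsilon> x \<longrightarrow> (\<exists>v. v \<epsilon> y \<and> maps_to D u v))
      \<and> (\<forall>v. v \<epsilon> y \<longrightarrow> (\<exists>u. u \<epsilon> A \<and> u \<epsilon> x \<and> maps_to D u v))"
    ..
  have DA: "x \<epsilon> A" and Dk: "y \<epsilon> k" if "maps_to D x y" for x y
    using D[rule_format, THEN iffD1, OF that] by blast+
  have down: "\<exists>v. v \<epsilon> y \<and> maps_to D u v" if "maps_to D x y" "u \<epsilon> A" "u \<epsilon> x" for x y u
    using D[rule_format, THEN iffD1, OF that(1)] that(2-) by blast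
  have down': "\<exists>u. u \<epsilon> A \<and> u \<epsilon> x \<and> maps_to D u v" if "maps_to D x y" "v \<epsilon> y" for x y v
    using D[rule_format, THEN iffD1, OF that(1)] that(2-) by blast
  have A_in_k: "x \<epsilon> k" if "x \<epsilon> A" for x
    using that Ak unfolding is_subset_def by blast
  have single_valued: "y = y'" if xy: "maps_to D x y" "maps_to D x y'" for x y y'
  proof (rule ccontr)
    let ?P = "\<lambda>x. \<exists>y y'. maps_to D x y \<and> maps_to D x y' \<and> y \<epsilon> y'"
    assume "y \<noteq> y'"
    then have P: "?P x" using xy ordinal_linear[OF k Dk[OF xy(1)] Dk[OF xy(2)]] by blast
    have "definable1 ?P"
      unfolding definable1_def definable_unfolds by (intro allI definable_intros)
    from ordinal_least[OF k this A_in_k[OF DA[OF xy(1)]] P] obtain m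
      where m: "?P m" "\<And>u. u \<epsilon> m \<Longrightarrow> \<not> ?P u"
      by blast
    then obtain z z' where z: "maps_to D m z" "maps_to D m z'" "z \<epsilon> z'" by blast
    \<comment> \<open>As \<open>z\<close> lies below the value \<open>z'\<close> of
      \<open>m\<close>, it is the value of some \<open>u\<close> below \<open>m\<close>. Since
      \<open>z\<close> is also a value of \<open>m\<close>, that \<open>u\<close> has a value below
      \<open>z\<close> as well, so \<open>u\<close> is a smaller element with two values.\<close>
    then obtain u where u: "u \<epsilon> A" "u \<epsilon> m" "maps_to D u z" using down' by blast
    then obtain v where v: "v \<epsilon> z" "maps_to D u v" using down z by blast
    then show False using m(2) u by blast
  qed
  have inject: "x = x'" if xy: "maps_to D x y" "maps_to D x' y" for x x' y
  proof -
    \<comment> \<open>A common value \<open>y\<close> would make \<open>x\<close> take a further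
      value below \<open>y\<close>, and single-valuedness would give
      \<open>y \<epsilon> y\<close>.\<close>
    have False if "maps_to D x y" "maps_to D x' y" "x \<epsilon> x'" for x x'
      using that down DA single_valued mem_irrefl by metis
    then show ?thesis using xy ordinal_linear[OF k] A_in_k DA by blast
  qed
  have "definable1 (\<lambda>v. \<exists>u. maps_to D u v)"
    unfolding definable1_def definable_unfolds by (intro allI definable_intros)
  from definable_separation[OF this, of k] obtain d
    where "\<forall>v. v \<epsilon> d \<longleftrightarrow> v \<epsilon> k \<and> (\<exists>u. maps_to D u v)" ..
  then have d: "v \<epsilon> d \<longleftrightarrow> (\<exists>u. maps_to D u v)" for v using Dk by blast
  have "is_subset d k" "is_transitive d"
    unfolding is_subset_def is_transitive_def d using Dk down' by blast+
  then have dk: "d = k \<or> d \<epsilon> k" using transitive_subset_ordinal[OF k] by blast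
  have not_increasing: "\<not> u \<epsilon> v" if uv: "maps_to D u v" for u v
  proof
    let ?P = "\<lambda>u. \<exists>v. maps_to D u v \<and> u \<epsilon> v"
    assume "u \<epsilon> v"
    then have P: "?P u" using uv by blast
    have "definable1 ?P"
      unfolding definable1_def definable_unfolds by (intro allI definable_intros)
    from ordinal_least[OF k this A_in_k[OF DA[OF uv]] P] obtain m
      where "?P m" "\<And>u. u \<epsilon> m \<Longrightarrow> \<not> ?P u"
      by blast
    \<comment> \<open>As \<open>m\<close> lies below its own value, \<open>m\<close> is the value of
      some \<open>u\<close> below it, which is a smaller counterexample.\<close>
    then show False using down' by blast
  qed
  have total: "\<exists>y. maps_to D x y" if "x \<epsilon> A" for x
  proof (rule ccontr)
    let ?P = "\<lambda>x. x \<epsilon> A \<and> \<not> (\<exists>y. maps_to D x y)"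
    assume "\<not> (\<exists>y. maps_to D x y)"
    with that have P: "?P x" by blast
    have "definable1 ?P"
      unfolding definable1_def definable_unfolds by (intro allI definable_intros)
    from ordinal_least[OF k this A_in_k[OF that] P] obtain m
      where m: "?P m" "\<And>u. u \<epsilon> m \<Longrightarrow> \<not> ?P u"
      by blast
    have below: "u \<epsilon> m" if "maps_to D u v" for u v
      using that m(1) down[OF that] ordinal_linear[OF k, of u m] A_in_k DA by blast
    \<comment> \<open>The elements of \<open>A\<close> that have a value are exactly those below
      \<open>m\<close>, so \<open>d\<close> satisfies the fixed-point equation as a value of
      \<open>m\<close>, provided that \<open>d\<close> is in \<open>k\<close>. If instead
      \<open>d = k\<close>, then \<open>m\<close> is the value of some \<open>u\<close> below
      \<open>m\<close>, contradicting \<open>not_increasing\<close>.\<close>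
    show False
    proof (cases "d = k")
      case True
      then obtain u where "maps_to D u m" using d A_in_k m(1) by blast
      then show False using below not_increasing by blast
    next
      case False
      then have "maps_to D m d"
        using dk D[rule_format, of m d] m below d DA by blast
      then show False using m(1) by blast
    qed
  qed
  have "definable2 (maps_to D)"
    unfolding definable2_def definable_unfolds by (intro allI definable_intros)
  then have "equipotent A d"
    by (rule definable_equipotent) (use total d DA single_valued inject in blast)+
  with dk show ?thesis by blast
qed

section \<open>Unbounded subsets of cardinals and cofinal subsets of the cofinality\<close>

text \<open>A bounded \<open>B\<close> would be a subset of \<open>b\<close>, hence equipotent to an
  ordinal up to \<open>b\<close>, and the cardinal \<open>l\<close> would be equipotent to one of
  its elements.\<close>

lemma cardinal_unbounded:
  assumes l: "is_cardinal l" and B: "is_subset B l" "equipotent B l" and b: "b \<epsilon> l"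
  shows "\<exists>x. x \<epsilon> B \<and> (b = x \<or> b \<epsilon> x)"
proof (rule ccontr)
  have ord: "is_ordinal l" using l unfolding is_cardinal_def by blast
  assume "\<not> ?thesis"
  then have "is_subset B b"
    using B(1) b ordinal_linear[OF ord] unfolding is_subset_def by blast
  then obtain d where d: "d = b \<or> d \<epsilon> b" "equipotent B d"
    using subset_ordinal_equipotent_ordinal[OF ordinal_element[OF ord b]] by blast
  then have "d \<epsilon> l" "equipotent d l"
    using b ordinal_transitive[OF ord b] equipotent_trans[OF equipotent_sym B(2)] by blast+
  then show False using l unfolding is_cardinal_def by blast
qed

lemma cofinal_subset_equipotent_cofinality:
  assumes kl: "is_cofinality k l" and f: "is_cofinal_map f k l" and A: "is_subset A k"
    and cofinal: "\<And>b. b \<epsilon> l \<Longrightarrow> \<exists>x y. x \<epsilon> A \<and> maps_to f x y \<and> (b = y \<or> b \<epsilon> y)"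
  shows "equipotent A k"
proof -
  have f: "is_function f k l" using f unfolding is_cofinal_map_def by blast
  then have f_total: "\<exists>!y. maps_to f x y" if "x \<epsilon> k" for x
    using that unfolding is_function_def by blast
  have "is_ordinal k" using kl unfolding is_cofinality_def by blast
  then obtain d where d: "d = k \<or> d \<epsilon> k" "equipotent A d"
    using subset_ordinal_equipotent_ordinal[OF _ A] by blast
  obtain h where "is_bijection h A d" using d unfolding equipotent_def by blast
  note h = bijectionD[OF this]
  let ?R = "\<lambda>v y. \<exists>x. maps_to h x v \<and> maps_to f x y"
  have "definable2 ?R"
    unfolding definable2_def definable_unfolds by (intro allI definable_intros)
  moreover have "\<exists>!y. y \<epsilon> l \<and> ?R v y" if v: "v \<epsilon> d" for v
  proof -
    obtain x where x: "maps_to h x v" using h(3) v by blast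
    then have "x \<epsilon> k" using h(1) A unfolding is_subset_def by blast
    then show ?thesis using f_total function_in[OF f] x h(5) by metis
  qed
  ultimately obtain g where g: "is_function g d l"
    "\<forall>v y. maps_to g v y \<longleftrightarrow> v \<epsilon> d \<and> y \<epsilon> l \<and> ?R v y"
    using definable_function[of ?R d l] by blast
  have "\<exists>v y. v \<epsilon> d \<and> maps_to g v y \<and> (b = y \<or> b \<epsilon> y)" if b: "b \<epsilon> l" for b
  proof -
    obtain x y where xy: "x \<epsilon> A" "maps_to f x y" "b = y \<or> b \<epsilon> y" using cofinal[OF b] by blast
    moreover obtain v where "maps_to h x v" using h(2) xy(1) by blast
    ultimately show ?thesis using g(2) h(1) function_in[OF f] by blast
  qed
  with g(1) have "\<exists>g. is_cofinal_map g d l" unfolding is_cofinal_map_def by blast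
  then have "d = k" using d(1) kl unfolding is_cofinality_def by blast
  with d(2) show ?thesis by simp
qed

section \<open>Images of ultrafilters\<close>

lemma ultrafilter_subset:
  assumes "is_ultrafilter_on F X" "A \<epsilon> F"
  shows "is_subset A X"
proof -
  have "\<forall>A. A \<epsilon> F \<longrightarrow> is_subset A X"
    using assms(1) unfolding is_ultrafilter_on_def by (elim conjE)
  with assms(2) show ?thesis by blast
qed

text \<open>This is the pushforward along the function given by \<open>R\<close>. Preimages commute
  with intersections and complements because \<open>R\<close> is single-valued from \<open>X\<close>
  to \<open>Y\<close>. The second conjunct is what transfers uniformity later.\<close>

lemma ultrafilter_image:
  assumes F: "is_ultrafilter_on F X" and R: "definable2 R"
    and R_fun: "\<And>x. x \<epsilon> X \<Longrightarrow> \<exists>!y. y \<epsilon> Y \<and> R x y"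
  shows "\<exists>G. is_ultrafilter_on G Y
    \<and> (\<forall>A. A \<epsilon> G \<longrightarrow> (\<exists>B. B \<epsilon> F \<and> (\<forall>x. x \<epsilon> B \<longleftrightarrow> x \<epsilon> X \<and> (\<exists>y. y \<epsilon> A \<and> R x y))))"
proof -
  have R': "definable (\<lambda>e. R (e i) (e j))" for i j
    using R unfolding definable2_def by blast
  define preim where "preim B A \<longleftrightarrow> (\<forall>x. x \<epsilon> B \<longleftrightarrow> x \<epsilon> X \<and> (\<exists>y. y \<epsilon> A \<and> R x y))" for A B
  have preim_ex: "\<exists>B. preim B A" for A
  proof -
    have "definable1 (\<lambda>x. \<exists>y. y \<epsilon> A \<and> R x y)"
      unfolding definable1_def by (intro allI R' definable_intros)
    from definable_separation[OF this] show ?thesis unfolding preim_def .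
  qed
  obtain P where P: "\<And>A. A \<epsilon> P \<longleftrightarrow> is_subset A Y" using powerset by blast
  have "definable1 (\<lambda>A. \<exists>B. B \<epsilon> F \<and> preim B A)"
    unfolding definable1_def preim_def by (intro allI R' definable_intros)
  from definable_separation[OF this] obtain G
    where "\<forall>A. A \<epsilon> G \<longleftrightarrow> A \<epsilon> P \<and> (\<exists>B. B \<epsilon> F \<and> preim B A)" ..
  then have G: "A \<epsilon> G \<longleftrightarrow> is_subset A Y \<and> (\<exists>B. B \<epsilon> F \<and> preim B A)" for A
    using P by blast
  have F1: "X \<epsilon> F"
    and F2: "\<And>A. A \<epsilon> F \<Longrightarrow> \<not> is_empty A"
    and F3: "\<And>A B. A \<epsilon> F \<Longrightarrow> is_subset A B \<Longrightarrow> is_subset B X \<Longrightarrow> B \<epsilon> F"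
    and F4: "\<And>A B. A \<epsilon> F \<Longrightarrow> B \<epsilon> F \<Longrightarrow> \<exists>C. C \<epsilon> F \<and> (\<forall>x. x \<epsilon> C \<longleftrightarrow> x \<epsilon> A \<and> x \<epsilon> B)"
    and F5: "\<And>A. is_subset A X \<Longrightarrow>
      A \<epsilon> F \<or> (\<exists>C. C \<epsilon> F \<and> (\<forall>x. x \<epsilon> C \<longleftrightarrow> x \<epsilon> X \<and> \<not> x \<epsilon> A))"
    using F unfolding is_ultrafilter_on_def by blast+
  have "is_ultrafilter_on G Y"
    unfolding is_ultrafilter_on_def
  proof (intro conjI allI impI; (elim conjE)?)
    show "is_subset A Y" if "A \<epsilon> G" for A using that G by blast
    have "preim X Y" unfolding preim_def using R_fun by blast
    then show "Y \<epsilon> G" using G F1 unfolding is_subset_def by blast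
    show "\<not> is_empty A" if "A \<epsilon> G" for A
      using that F2 unfolding G preim_def is_empty_def by blast
  next
    fix A B assume A: "A \<epsilon> G" and AB: "is_subset A B" and B: "is_subset B Y"
    obtain A' B' where "A' \<epsilon> F" "preim A' A" "preim B' B" using A G preim_ex by blast
    moreover from this have "is_subset A' B'" "is_subset B' X"
      using AB unfolding preim_def is_subset_def by blast+
    ultimately show "B \<epsilon> G" using F3 G B by blast
  next
    fix A B assume A: "A \<epsilon> G" and B: "B \<epsilon> G"
    have "definable1 (\<lambda>x. x \<epsilon> B)" unfolding definable1_def by (intro allI definable_intros)
    from definable_separation[OF this, of A] obtain C
      where C: "\<And>x. x \<epsilon> C \<longleftrightarrow> x \<epsilon> A \<and> x \<epsilon> B" by auto
    obtain A' B' where A'B': "A' \<epsilon> F" "preim A' A" "B' \<epsilon> F" "preim B' B" using A B G by blast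
    then obtain C' where C': "C' \<epsilon> F" "\<And>x. x \<epsilon> C' \<longleftrightarrow> x \<epsilon> A' \<and> x \<epsilon> B'" using F4 by blast
    have AB: "is_subset A Y" "is_subset B Y" using A B G by blast+
    have "x \<epsilon> C' \<longleftrightarrow> x \<epsilon> X \<and> (\<exists>y. y \<epsilon> C \<and> R x y)" for x
    proof -
      have "x \<epsilon> A' \<longleftrightarrow> x \<epsilon> X \<and> (\<exists>y. y \<epsilon> A \<and> R x y)"
        "x \<epsilon> B' \<longleftrightarrow> x \<epsilon> X \<and> (\<exists>y. y \<epsilon> B \<and> R x y)"
        using A'B'(2,4) unfolding preim_def by blast+
      \<comment> \<open>A point in both preimages has a value in \<open>A\<close> and a value in
        \<open>B\<close>; being the same element of \<open>Y\<close>, it lies in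
        \<open>C\<close>.\<close>
      moreover have "x \<epsilon> X \<Longrightarrow> y \<epsilon> A \<Longrightarrow> R x y \<Longrightarrow> z \<epsilon> B \<Longrightarrow> R x z \<Longrightarrow> y = z" for y z
        using R_fun[of x] AB unfolding is_subset_def by blast
      ultimately show ?thesis unfolding C'(2) C by blast
    qed
    then have "preim C' C" unfolding preim_def by blast
    moreover have "is_subset C Y" using AB C unfolding is_subset_def by blast
    ultimately show "\<exists>C. C \<epsilon> G \<and> (\<forall>x. x \<epsilon> C \<longleftrightarrow> x \<epsilon> A \<and> x \<epsilon> B)" using C C' G by blast
  next
    fix A assume A: "is_subset A Y"
    have "definable1 (\<lambda>x. \<not> x \<epsilon> A)" unfolding definable1_def by (intro allI definable_intros)
    from definable_separation[OF this, of Y] obtain C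
      where C: "\<And>x. x \<epsilon> C \<longleftrightarrow> x \<epsilon> Y \<and> \<not> x \<epsilon> A" by auto
    obtain A' where A': "preim A' A" using preim_ex by blast
    then have "is_subset A' X" unfolding preim_def is_subset_def by blast
    then consider "A' \<epsilon> F" | C' where "C' \<epsilon> F" "\<And>x. x \<epsilon> C' \<longleftrightarrow> x \<epsilon> X \<and> \<not> x \<epsilon> A'" using F5 by blast
    then show "A \<epsilon> G \<or> (\<exists>C. C \<epsilon> G \<and> (\<forall>x. x \<epsilon> C \<longleftrightarrow> x \<epsilon> Y \<and> \<not> x \<epsilon> A))"
    proof cases
      case 1
      then show ?thesis using A A' G by blast
    next
      case 2
      \<comment> \<open>The unique value of \<open>x\<close> in \<open>Y\<close> lies in exactly one
        of \<open>A\<close> and \<open>C\<close>.\<close>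
      have "x \<epsilon> C' \<longleftrightarrow> x \<epsilon> X \<and> (\<exists>y. y \<epsilon> C \<and> R x y)" for x
      proof -
        have "x \<epsilon> A' \<longleftrightarrow> x \<epsilon> X \<and> (\<exists>y. y \<epsilon> A \<and> R x y)"
          using A' unfolding preim_def by blast
        moreover have "y \<epsilon> A \<Longrightarrow> y \<epsilon> Y" for y using A unfolding is_subset_def by blast
        ultimately show ?thesis using R_fun[of x] unfolding 2(2) C by blast
      qed
      then have "preim C' C" unfolding preim_def by blast
      moreover have "is_subset C Y" using C unfolding is_subset_def by blast
      ultimately show ?thesis using 2(1) C G by blast
    qed
  qed
  then show ?thesis using G unfolding preim_def by blast
qed

section \<open>The uniform ultrafilter on the cofinality\<close>

lemma uniform_ultrafilter_on_cofinality:
  assumes l: "is_cardinal l" and kl: "is_cofinality k l" and F: "is_uniform_ultrafilter_on F l"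
  shows "\<exists>G. is_uniform_ultrafilter_on G k"
proof -
  have k: "is_ordinal k" using kl unfolding is_cofinality_def by blast
  have l_ord: "is_ordinal l" using l unfolding is_cardinal_def by blast
  obtain f where f: "is_cofinal_map f k l" using kl unfolding is_cofinality_def by blast
  let ?below = "\<lambda>a i. \<exists>y. maps_to f i y \<and> (a = y \<or> a \<epsilon> y)"
  \<comment> \<open>Taking the least index makes the relation a function without any choice.\<close>
  let ?R = "\<lambda>a i. ?below a i \<and> (\<forall>j. j \<epsilon> i \<longrightarrow> \<not> ?below a j)"
  have R: "definable2 ?R"
    unfolding definable2_def definable_unfolds by (intro allI definable_intros)
  have R_fun: "\<exists>!i. i \<epsilon> k \<and> ?R a i" if a: "a \<epsilon> l" for a
  proof -
    have "definable1 (?below a)"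
      unfolding definable1_def definable_unfolds by (intro allI definable_intros)
    moreover obtain i where "i \<epsilon> k" "?below a i" using f a unfolding is_cofinal_map_def by blast
    ultimately obtain m where "m \<epsilon> k" "?R a m" using ordinal_least[OF k] by blast
    moreover have "i = j" if "i \<epsilon> k" "j \<epsilon> k" "?R a i" "?R a j" for i j
      using that ordinal_linear[OF k, of i j] by blast
    ultimately show ?thesis by blast
  qed
  have F_ultra: "is_ultrafilter_on F l" and F_uniform: "\<And>B. B \<epsilon> F \<Longrightarrow> equipotent B l"
    using F unfolding is_uniform_ultrafilter_on_def by blast+
  from ultrafilter_image[OF F_ultra R R_fun] obtain G where G: "is_ultrafilter_on G k"
    "\<forall>A. A \<epsilon> G \<longrightarrow> (\<exists>B. B \<epsilon> F \<and> (\<forall>x. x \<epsilon> B \<longleftrightarrow> x \<epsilon> l \<and> (\<exists>i. i \<epsilon> A \<and> ?R x i)))"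
    by blast
  have "equipotent A k" if A: "A \<epsilon> G" for A
  proof -
    from G(2)[rule_format, OF A] obtain B
      where B: "B \<epsilon> F" "\<forall>x. x \<epsilon> B \<longleftrightarrow> x \<epsilon> l \<and> (\<exists>i. i \<epsilon> A \<and> ?R x i)"
      by (elim exE conjE)
    have "\<exists>i y. i \<epsilon> A \<and> maps_to f i y \<and> (b = y \<or> b \<epsilon> y)" if b: "b \<epsilon> l" for b
    proof -
      \<comment> \<open>The unbounded set \<open>B\<close> supplies \<open>x\<close> at or above
        \<open>b\<close>, and the index \<open>i\<close> in \<open>A\<close> assigned to
        \<open>x\<close> has its \<open>f\<close>-value at or above \<open>x\<close>.\<close>
      obtain x where x: "x \<epsilon> B" "b = x \<or> b \<epsilon> x"
        using cardinal_unbounded[OF l ultrafilter_subset[OF F_ultra B(1)] F_uniform[OF B(1)] b]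
        by blast
      then obtain i y where iy: "i \<epsilon> A" "maps_to f i y" "x = y \<or> x \<epsilon> y"
        using B(2)[rule_format, THEN iffD1, OF x(1)] by blast
      then have "y \<epsilon> l" using f function_in unfolding is_cofinal_map_def by blast
      then have "b = y \<or> b \<epsilon> y" using x(2) iy(3) ordinal_mem_trans[OF l_ord] by blast
      with iy show ?thesis by blast
    qed
    then show ?thesis
      by (rule cofinal_subset_equipotent_cofinality[OF kl f ultrafilter_subset[OF G(1) A]])
  qed
  with G(1) show ?thesis unfolding is_uniform_ultrafilter_on_def by blast
qed

end

theorem theorem5p1:
  fixes mem :: "'a \<Rightarrow> 'a \<Rightarrow> bool" and lam kap :: 'a
  assumes "ZF_model mem"
    and "set_structure.is_singular_cardinal mem lam"
    and "set_structure.is_cofinality mem kap lam"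
    and "\<exists>F. set_structure.is_uniform_ultrafilter_on mem F lam"
  shows "\<exists>F. set_structure.is_uniform_ultrafilter_on mem F kap"
proof -
  interpret ZF_model mem by (fact assms(1))
  show ?thesis
    using assms(2-4) uniform_ultrafilter_on_cofinality unfolding is_singular_cardinal_def by blast
qed

end
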